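(* For every integer $n\ge 0$, \begin{align*} H_{4n}(F(x,8))&= H_{4n+1}(F(x,8))=(n+1)^3, \\ H_{4n+2}(F(x,8))&=\tfrac2{45} (n+1)^2(n+2)(2n+3)(64n^2+32n-75),\\ H_{4n+3}(F(x,8))&=-\tfrac2{45} (n+1)(n+2)^2(2n+3)(64n^2+352n+405). \end{align*}
   Context: For a power series $A(x)=\sum_{n\ge 0}a_nx^n$, the Hankel determinants are $H_n(A(x))=\det(a_{i+j})_{0\le i,j\le n-1}$ for $n\ge 1$, with $H_0(A(x))=1$. Let $C(x)=\sum_{n\ge0}C_nx^n$ with $C_n=\frac1{n+1}\binom{2n}{n}$ be the Catalan generating function (the unique power series with $C(x)=1+xC(x)^2$), and $F(x,r)=C(x)^r=\sum_{n\ge 0}\frac{r}{2n+r}\binom{2n+r}{n}x^n$ for positive integers $r$. *)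

theory Defs
  imports
    "HOL-Computational_Algebra.Formal_Power_Series"
    "Jordan_Normal_Form.Determinant"
begin

text \<open>For \<open>n = 0\<close> this is the determinant of the empty matrix, which is \<open>1\<close>.\<close>

definition hankel_det :: "nat \<Rightarrow> 'a::comm_ring_1 fps \<Rightarrow> 'a" where
  "hankel_det n A = det (mat n n (\<lambda>(i, j). fps_nth A (i + j)))"

lemma hankel_det_0: "hankel_det 0 A = 1"
  by (simp add: hankel_det_def det_dim_zero)

definition catalan_fps :: "rat fps" where
  "catalan_fps = Abs_fps (\<lambda>n. 1 / (of_nat n + 1) * of_nat ((2 * n) choose n))"

definition catalan_power_fps :: "nat \<Rightarrow> rat fps" where
  "catalan_power_fps r = catalan_fps ^ r"

end

theory Submission
  imports Defs
begin

text \<open>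
Two general facts carry the proof. First, if for every k there is a polynomial \<open>D\<close> of degree at
most k with constant term 1 such that \<open>D * F = N + h * X ^ (2 * k) + ...\<close> with \<open>N\<close> of degree below k
(a Pade approximant of \<open>F\<close>), then the coefficients of these \<open>D\<close>, reversed, form a unitriangular
matrix that makes the Hankel matrix of \<open>F\<close> upper triangular with the \<open>h\<close> on the diagonal. So
\<open>hankel_det (k + 1) F / hankel_det k F = h\<close> (\<open>hankel_det_Suc\<close>), and it remains to exhibit the
approximants.

Secondly, put z = C - 1. The quadratic equation for the Catalan series C reads x = z / (1 + z)^2,
and C^8 = (1 + z)^8 = (z / x)^4. Since z + 1/z = 1/x - 2, the function z^4 + z^(-4) is a polynomial
of degree 4 in 1/x. Hence the Chebyshev-like quotients P_m = (z^(4m) - z^(-4m)) / (z^4 - z^(-4)) are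
polynomials of degree 4 (m - 1) in 1/x, and from P_(m+1) - z^(4m) = z^(-4) P_m one reads off
that their reversals R_m (\<open>pade_denom m\<close>) satisfy
\<open>R_(m+1) * C^8 = R_m + X^(8m) * C^(8m + 8)\<close> (\<open>pade_denom_mult_catalan\<close>). So R_(m+1) is the
denominator for k = 4m, with pivot 1. This explains the period 4.

For k = 4m + e with e = 1, 2, 3 the denominator is sought in the form
\<open>D = B * R_(m+2) + X^(2e) * A * R_(m+1)\<close> with B of degree e - 1, constant term 1, and A of
degree 3 - e. Multiplying by C^8 gives a numerator of degree below k and an error starting with
\<open>A(0) * X^(2k)\<close>, whatever A and B are; only the degree of D is too large, namely k + 3. The three
free coefficients of A and B are determined by the vanishing of the three top coefficients of D
(\<open>pade_pivot_combination\<close>). The top coefficients of R_m are the Taylor coefficients of P_m at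
1/x = 0, that is at z = -1; they are polynomials in m (\<open>pade_top_nth\<close>), so A(0) is a rational
function of m, and the determinants follow by multiplying up the pivots.
\<close>

section \<open>Hankel determinants from Pade approximants\<close>

text \<open>The polynomial \<open>D\<close> is the denominator of a Pade approximant of \<open>F\<close>. Its reversal
t^k D(1/t) is the monic orthogonal polynomial of degree k for the functional with moments
\<open>fps_nth F\<close>, and \<open>h\<close> is its square norm.\<close>

definition pade_pivot :: "'a::comm_ring_1 fps \<Rightarrow> nat \<Rightarrow> 'a fps \<Rightarrow> 'a \<Rightarrow> bool" where
  "pade_pivot F k D h \<longleftrightarrow> fps_nth D 0 = 1 \<and> (\<forall>l>k. fps_nth D l = 0) \<and>
     (\<exists>N E. D * F = N + fps_X ^ (2 * k) * E \<and> (\<forall>l\<ge>k. fps_nth N l = 0) \<and> fps_nth E 0 = h)"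

text \<open>Row k of the unitriangular matrix \<open>T\<close> holds the coefficients of the k-th orthogonal
polynomial. Entry (k, i) of \<open>T * H\<close> is then the coefficient of \<open>D k * F\<close> at k + i, which lies
in the gap between the numerator and the error term for i < k and is the pivot for i = k.\<close>

lemma hankel_det_eq_prod:
  fixes F :: "'a::comm_ring_1 fps"
  assumes pade: "\<And>k. k < n \<Longrightarrow> pade_pivot F k (D k) (h k)"
  shows "hankel_det n F = (\<Prod>k<n. h k)"
proof -
  define H where "H = mat n n (\<lambda>(i, j). fps_nth F (i + j))"
  define T where "T = mat n n (\<lambda>(k, j). if j \<le> k then fps_nth (D k) (k - j) else 0)"
  have carrier: "H \<in> carrier_mat n n" "T \<in> carrier_mat n n"
    by (auto simp: H_def T_def)
  have TH: "(T * H) $$ (k, i) = fps_nth (D k * F) (k + i)" if "k < n" "i < n" for k i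
  proof -
    have vanish: "fps_nth (D k) l = 0" if "l > k" for l
      using pade[OF \<open>k < n\<close>] that by (auto simp: pade_pivot_def)
    have "(T * H) $$ (k, i) = (\<Sum>j<n. (if j \<le> k then fps_nth (D k) (k - j) else 0) * fps_nth F (j + i))"
      using that by (simp add: T_def H_def scalar_prod_def lessThan_atLeast0)
    also have "\<dots> = (\<Sum>j\<le>k. fps_nth (D k) (k - j) * fps_nth F (j + i))"
      using \<open>k < n\<close> by (intro sum.mono_neutral_cong_right) auto
    also have "\<dots> = (\<Sum>l\<le>k. fps_nth (D k) l * fps_nth F (k + i - l))"
      by (rule sum.reindex_bij_witness[of _ "\<lambda>l. k - l" "\<lambda>j. k - j"]) (auto simp: add.commute)
    also have "\<dots> = (\<Sum>l=0..k + i. fps_nth (D k) l * fps_nth F (k + i - l))"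
      by (intro sum.mono_neutral_left) (auto simp: vanish)
    finally show ?thesis by (simp add: fps_mult_nth)
  qed
  have entry: "(T * H) $$ (k, i) = (if i = k then h k else 0)" if "k < n" "i \<le> k" for k i
  proof -
    obtain N E where NE: "D k * F = N + fps_X ^ (2 * k) * E" "\<forall>l\<ge>k. fps_nth N l = 0" "fps_nth E 0 = h k"
      using pade[OF \<open>k < n\<close>] by (auto simp: pade_pivot_def)
    have "fps_nth (D k * F) (k + i) = (if i = k then h k else 0)"
      using NE(2,3) that by (auto simp: NE(1) fps_X_power_mult_nth mult_2)
    then show ?thesis using TH that by simp
  qed
  have "det T = 1"
  proof -
    have "det T = prod_list (diag_mat T)"
      by (rule det_lower_triangular[OF _ carrier(2)]) (auto simp: T_def)
    also have "diag_mat T = map (\<lambda>i. 1) [0..<n]"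
      unfolding diag_mat_def using pade by (auto simp: T_def pade_pivot_def)
    finally show ?thesis by (simp add: map_replicate_const)
  qed
  moreover have "det (T * H) = (\<Prod>k<n. h k)"
  proof -
    have "det (T * H) = prod_list (diag_mat (T * H))"
      by (rule det_upper_triangular[where n = n]) (use carrier entry in \<open>auto simp: upper_triangular_def\<close>)
    also have "diag_mat (T * H) = map h [0..<n]"
      unfolding diag_mat_def using carrier entry by auto
    finally show ?thesis using prod.distinct_set_conv_list[of "[0..<n]" h] by (simp add: lessThan_atLeast0)
  qed
  ultimately show ?thesis
    using det_mult[OF carrier(2,1)] by (simp add: hankel_det_def H_def)
qed

lemma hankel_det_Suc:
  fixes F :: "'a::comm_ring_1 fps"
  assumes pade: "\<And>k. k < n \<Longrightarrow> \<exists>D h. pade_pivot F k D h" and last: "pade_pivot F n D h"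
  shows "hankel_det (Suc n) F = h * hankel_det n F"
proof -
  obtain D' h' where D'h': "\<And>k. k < n \<Longrightarrow> pade_pivot F k (D' k) (h' k)"
    using pade by metis
  have "hankel_det n F = (\<Prod>k<n. h' k)"
    using D'h' by (rule hankel_det_eq_prod)
  moreover have "hankel_det (Suc n) F = (\<Prod>k<Suc n. (h'(n := h)) k)"
    by (rule hankel_det_eq_prod[where D = "D'(n := D)"]) (use D'h' last in \<open>auto simp: less_Suc_eq\<close>)
  moreover have "(\<Prod>k<n. (h'(n := h)) k) = (\<Prod>k<n. h' k)"
    by (intro prod.cong) auto
  ultimately show ?thesis by (simp add: mult.commute)
qed

section \<open>The Catalan series\<close>

lemma catalan_coeff_rec:
  "(of_nat n + 2) * fps_nth catalan_fps (Suc n) = (4 * of_nat n + 2) * fps_nth catalan_fps n"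
proof -
  have "Suc n * (Suc n * ((2 * Suc n) choose Suc n)) = Suc n * ((4 * n + 2) * ((2 * n) choose n))"
  proof -
    have "Suc n * (Suc (Suc (2 * n)) choose Suc n) = Suc (Suc (2 * n)) * (Suc (2 * n) choose n)"
      by (rule Suc_times_binomial)
    moreover have "Suc n * (Suc (2 * n) choose n) = Suc (2 * n) * ((2 * n) choose n)"
      using binomial_absorb_comp[of "Suc (2 * n)" n] by (simp add: Suc_diff_le)
    ultimately show ?thesis by (simp add: algebra_simps)
  qed
  then have "Suc n * ((2 * Suc n) choose Suc n) = (4 * n + 2) * ((2 * n) choose n)"
    by (metis mult_cancel1 nat.distinct(1))
  then have "of_nat (Suc n * ((2 * Suc n) choose Suc n)) = (of_nat ((4 * n + 2) * ((2 * n) choose n)) :: rat)"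
    by (rule arg_cong)
  then have eq: "(of_nat n + 1) * of_nat ((2 * Suc n) choose Suc n)
      = (4 * of_nat n + 2) * (of_nat ((2 * n) choose n) :: rat)"
    by (simp only: of_nat_mult of_nat_add of_nat_Suc of_nat_numeral add.commute)
  have pos: "of_nat n + 1 \<noteq> (0::rat)" "of_nat n + 2 \<noteq> (0::rat)" 
    by linarith+
  have "fps_nth catalan_fps (Suc n) = of_nat ((2 * Suc n) choose Suc n) / (of_nat n + 2)"
    "fps_nth catalan_fps n = of_nat ((2 * n) choose n) / (of_nat n + 1)"
    by (simp_all only: catalan_fps_def fps_nth_Abs_fps of_nat_Suc) simp_all
  then show ?thesis
    using pos eq by (metis nonzero_mult_div_cancel_left times_divide_eq_right)
qed

lemma catalan_fps_nth_0: "fps_nth catalan_fps 0 = 1"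
  by (simp add: catalan_fps_def)

text \<open>The quadratic equation says that G = 1 - 2xC has the square 1 - 4x. The recurrence for the
coefficients turns into the differential equation (1 - 4x) G' = -2 G of the square root, so
Y = G^2 satisfies (1 - 4x) Y' = -4 Y with Y(0) = 1, which determines Y.\<close>

lemma catalan_quadratic: "fps_X * catalan_fps ^ 2 = catalan_fps - 1"
proof -
  define G where "G = 1 - 2 * fps_X * catalan_fps"
  have G_nth: "fps_nth G n = (case n of 0 \<Rightarrow> 1 | Suc k \<Rightarrow> - 2 * fps_nth catalan_fps k)" for n
    by (cases n) (simp_all add: G_def mult.assoc fps_numeral_fps_const)
  have deriv_G: "(1 - 4 * fps_X) * fps_deriv G = - 2 * G"
  proof (rule fps_ext)
    fix n
    show "fps_nth ((1 - 4 * fps_X) * fps_deriv G) n = fps_nth (- 2 * G) n"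
    proof (cases n)
      case (Suc k)
      then show ?thesis using catalan_coeff_rec[of k]
        by (simp add: G_nth algebra_simps fps_numeral_fps_const)
    qed (simp add: G_nth catalan_fps_nth_0 algebra_simps fps_numeral_fps_const)
  qed
  define Y where "Y = G ^ 2"
  have "(1 - 4 * fps_X) * fps_deriv Y = 2 * G * ((1 - 4 * fps_X) * fps_deriv G)"
    by (simp add: Y_def power2_eq_square algebra_simps)
  then have deriv_Y: "(1 - 4 * fps_X) * fps_deriv Y = - 4 * Y"
    by (simp add: deriv_G Y_def power2_eq_square)
  have Y_rec: "of_nat (Suc n) * fps_nth Y (Suc n) = 4 * (of_nat n - 1) * fps_nth Y n" for n
    using arg_cong[OF deriv_Y, of "\<lambda>f. fps_nth f n"]
    by (cases n) (simp_all add: algebra_simps fps_numeral_fps_const)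
  have Y_0: "fps_nth Y 0 = 1" by (simp add: Y_def G_nth power2_eq_square)
  have Y_1: "fps_nth Y (Suc 0) = - 4" using Y_rec[of 0] Y_0 by simp
  have Y_ge2: "fps_nth Y (Suc (Suc n)) = 0" for n
  proof (induction n)
    case 0
    show ?case using Y_rec[of 1] by simp
  next
    case (Suc n)
    then show ?case using Y_rec[of "Suc (Suc n)"] by (simp del: of_nat_Suc)
  qed
  have "Y = 1 - 4 * fps_X"
  proof (rule fps_ext)
    fix n
    show "fps_nth Y n = fps_nth (1 - 4 * fps_X) n"
      by (cases n; cases "n - 1") (simp_all add: Y_0 Y_1 Y_ge2 fps_numeral_fps_const)
  qed
  then have "4 * fps_X * (fps_X * catalan_fps ^ 2) = 4 * fps_X * (catalan_fps - 1)"
    by (simp add: Y_def G_def power2_eq_square algebra_simps)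
  then show ?thesis by simp
qed

section \<open>Approximants of order divisible by four\<close>

text \<open>With z = C - 1 this is x^4 (z^4 + z^(-4)): the Chebyshev polynomial y^4 - 4 y^2 + 2 at
y = z + 1/z = 1/x - 2, with the order of its coefficients in 1/x reversed.\<close>

definition cheb4 :: "rat fps" where
  "cheb4 = 1 - 8 * fps_X + 20 * fps_X ^ 2 - 16 * fps_X ^ 3 + 2 * fps_X ^ 4"

text \<open>Since C^8 = (z / x)^4, this is the identity z^4 (z^4 + z^(-4)) = 1 + z^8.\<close>

lemma cheb4_catalan: "cheb4 * catalan_fps ^ 8 = 1 + fps_X ^ 8 * catalan_fps ^ 16"
proof -
  have X: "fps_X ^ k * catalan_fps ^ (2 * k) = (catalan_fps - 1) ^ k" for k
    using catalan_quadratic by (metis power_mult power_mult_distrib)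
  have "cheb4 * catalan_fps ^ 8 = catalan_fps ^ 8
      - 8 * (fps_X ^ 1 * catalan_fps ^ (2 * 1)) * catalan_fps ^ 6
      + 20 * (fps_X ^ 2 * catalan_fps ^ (2 * 2)) * catalan_fps ^ 4
      - 16 * (fps_X ^ 3 * catalan_fps ^ (2 * 3)) * catalan_fps ^ 2
      + 2 * (fps_X ^ 4 * catalan_fps ^ (2 * 4))"
    unfolding cheb4_def by (simp add: algebra_simps power_numeral_reduce)
  also have "\<dots> = 1 + (catalan_fps - 1) ^ 8"
    by (simp only: X) (simp add: algebra_simps power_numeral_reduce)
  also have "(catalan_fps - 1) ^ 8 = fps_X ^ 8 * catalan_fps ^ 16"
    using X[of 8] by simp
  finally show ?thesis .
qed

text \<open>The reversal of (z^(4m) - z^(-4m)) / (z^4 - z^(-4)) as a polynomial of degree 4 (m - 1) in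
1/x. Starting the recurrence with 0 makes the index of the numerator of an approximant one less than
that of its denominator.\<close>

fun pade_denom :: "nat \<Rightarrow> rat fps" where
  "pade_denom 0 = 0"
| "pade_denom (Suc 0) = 1"
| "pade_denom (Suc (Suc m)) = cheb4 * pade_denom (Suc m) - fps_X ^ 8 * pade_denom m"

text \<open>Each of the three terms solves the recurrence of \<open>pade_denom\<close> in m. For the error term, and
in the initial case m = 1, this amounts to \<open>cheb4_catalan\<close>.\<close>

lemma pade_denom_mult_catalan:
  "pade_denom (Suc m) * catalan_fps ^ 8 = pade_denom m + fps_X ^ (8 * m) * catalan_fps ^ (8 * m + 8)"
proof (induction m rule: pade_denom.induct)
  case 1
  then show ?case by simp
next
  case 2
  then show ?case by (simp add: cheb4_catalan)
next
  case (3 m)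
  let ?C = catalan_fps and ?M = "fps_X ^ (8 * m + 8) * catalan_fps ^ (8 * m + 8)"
  have "pade_denom (Suc (Suc (Suc m))) * ?C ^ 8
      = cheb4 * (pade_denom (Suc (Suc m)) * ?C ^ 8) - fps_X ^ 8 * (pade_denom (Suc m) * ?C ^ 8)"
    by (simp add: algebra_simps)
  also have "\<dots> = pade_denom (Suc (Suc m)) + ?M * (cheb4 * ?C ^ 8 - 1)"
    unfolding 3 by (simp add: algebra_simps power_add)
  also have "?M * (cheb4 * ?C ^ 8 - 1) = fps_X ^ (8 * Suc (Suc m)) * ?C ^ (8 * Suc (Suc m) + 8)"
  proof -
    have "fps_X ^ (8 * Suc (Suc m)) = fps_X ^ 8 * (fps_X ^ (8 * m + 8) :: rat fps)"
      "?C ^ (8 * Suc (Suc m) + 8) = ?C ^ 16 * ?C ^ (8 * m + 8)"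
      by (simp_all flip: power_add)
    then show ?thesis unfolding cheb4_catalan by (simp only: add_diff_cancel_left' mult_ac)
  qed
  finally show ?case .
qed

lemma cheb4_mult_nth:
  "fps_nth (cheb4 * f) n = fps_nth f n - 8 * fps_nth (fps_X * f) n + 20 * fps_nth (fps_X ^ 2 * f) n
     - 16 * fps_nth (fps_X ^ 3 * f) n + 2 * fps_nth (fps_X ^ 4 * f) n"
  by (simp add: cheb4_def ring_distribs mult.assoc fps_numeral_fps_const)

lemma pade_denom_nth_0: "fps_nth (pade_denom (Suc m)) 0 = 1"
  by (induction m rule: pade_denom.induct)
    (simp_all add: cheb4_mult_nth cheb4_def fps_X_power_nth fps_numeral_fps_const)

text \<open>The degree bound 4 (m - 1), in a form that also covers the zero polynomial at m = 0.\<close>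

lemma pade_denom_nth_eq_0: "4 * m < l + 4 \<Longrightarrow> fps_nth (pade_denom m) l = 0"
proof (induction m arbitrary: l rule: pade_denom.induct)
  case (3 m)
  then show ?case by (simp add: cheb4_mult_nth fps_X_power_mult_nth fps_X_mult_nth)
qed auto

text \<open>The factor \<open>fps_X ^ 2\<close> moves the three top coefficients, of degrees 4m, 4m - 1 and 4m - 2, to
the indices 4m + 2, 4m + 1 and 4m, which are natural numbers for m = 0 as well.\<close>

definition pade_top :: "nat \<Rightarrow> rat fps" where
  "pade_top m = fps_X ^ 2 * pade_denom (Suc m)"

lemma pade_top_nth_eq_0: "l > 4 * m + 2 \<Longrightarrow> fps_nth (pade_top m) l = 0"
  unfolding pade_top_def fps_X_power_mult_nth by (auto intro!: pade_denom_nth_eq_0)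

text \<open>In terms of t = 1/x the recurrence reads P_(m+1) = c P_m - P_(m-1) with
c = 2 - 16 t + 20 t^2 + O(t^3). Hence the coefficients p0, p1, p2 of t^0, t^1, t^2 in P_m have the
second differences 0, -16 p0 and -16 p1 + 20 p0 in m, which makes them polynomials in m.\<close>

lemma pade_top_nth:
  fixes m :: nat
  defines "\<mu> \<equiv> of_nat m + (1 :: rat)"
  shows "fps_nth (pade_top m) (4 * m + 2) = \<mu>"
    and "fps_nth (pade_top m) (4 * m + 1) = - (8 / 3) * \<mu> * (\<mu>\<^sup>2 - 1)"
    and "fps_nth (pade_top m) (4 * m) = \<mu> * (\<mu>\<^sup>2 - 1) * (32 * \<mu>\<^sup>2 - 78) / 15"
proof -
  let ?\<mu> = "\<lambda>m::nat. of_nat m + (1 :: rat)"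
  have "fps_nth (pade_top m) (4 * m + 2) = ?\<mu> m \<and>
        fps_nth (pade_top m) (4 * m + 1) = - (8 / 3) * ?\<mu> m * ((?\<mu> m)\<^sup>2 - 1) \<and>
        fps_nth (pade_top m) (4 * m) = ?\<mu> m * ((?\<mu> m)\<^sup>2 - 1) * (32 * (?\<mu> m)\<^sup>2 - 78) / 15"
  proof (induction m rule: pade_denom.induct)
    case 1
    then show ?case by (simp add: pade_top_def fps_X_power_nth)
  next
    case 2
    show ?case
      by (simp add: pade_top_def cheb4_def fps_X_power_mult_nth fps_X_power_nth fps_numeral_fps_const)
  next
    case (3 m)
    have vanish: "fps_nth (pade_top (Suc m)) l = 0" if "l > 4 * m + 6" for l
      using that by (simp add: pade_top_nth_eq_0)
    have rec: "pade_top (Suc (Suc m)) = cheb4 * pade_top (Suc m) - fps_X ^ 8 * pade_top m"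
      by (simp add: pade_top_def algebra_simps)
    have IH: "fps_nth (pade_top (Suc m)) (4 * m + 6) = ?\<mu> (Suc m)"
      "fps_nth (pade_top (Suc m)) (4 * m + 5) = - (8 / 3) * ?\<mu> (Suc m) * ((?\<mu> (Suc m))\<^sup>2 - 1)"
      "fps_nth (pade_top (Suc m)) (4 * m + 4) =
         ?\<mu> (Suc m) * ((?\<mu> (Suc m))\<^sup>2 - 1) * (32 * (?\<mu> (Suc m))\<^sup>2 - 78) / 15"
      using 3(1) by (simp_all add: add_ac)
    have new0: "fps_nth (pade_top (Suc (Suc m))) (4 * m + 10) = 2 * ?\<mu> (Suc m) - ?\<mu> m"
      unfolding rec using 3(2) IH
      by (simp add: cheb4_mult_nth fps_X_power_mult_nth vanish add.commute[of _ "4 * m"])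
    have new1: "fps_nth (pade_top (Suc (Suc m))) (4 * m + 9) =
        - 16 * ?\<mu> (Suc m) + 2 * (- (8 / 3) * ?\<mu> (Suc m) * ((?\<mu> (Suc m))\<^sup>2 - 1))
        + (8 / 3) * ?\<mu> m * ((?\<mu> m)\<^sup>2 - 1)"
      unfolding rec using 3(2) IH
      by (simp add: cheb4_mult_nth fps_X_power_mult_nth vanish add.commute[of _ "4 * m"])
    have new2: "fps_nth (pade_top (Suc (Suc m))) (4 * m + 8) =
        20 * ?\<mu> (Suc m) + 16 * (8 / 3 * ?\<mu> (Suc m) * ((?\<mu> (Suc m))\<^sup>2 - 1))
        + 2 * (?\<mu> (Suc m) * ((?\<mu> (Suc m))\<^sup>2 - 1) * (32 * (?\<mu> (Suc m))\<^sup>2 - 78) / 15)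
        - ?\<mu> m * ((?\<mu> m)\<^sup>2 - 1) * (32 * (?\<mu> m)\<^sup>2 - 78) / 15"
      unfolding rec using 3(2) IH
      by (simp add: cheb4_mult_nth fps_X_power_mult_nth vanish add.commute[of _ "4 * m"])
    have idx: "4 * Suc (Suc m) + 2 = 4 * m + 10" "4 * Suc (Suc m) + 1 = 4 * m + 9"
      "4 * Suc (Suc m) = 4 * m + 8"
      by simp_all
    show ?case
      unfolding idx(1,2) new0 new1 unfolding idx(3) new2 of_nat_Suc
      by (simp add: field_simps power2_eq_square)
  qed
  then show "fps_nth (pade_top m) (4 * m + 2) = \<mu>"
    and "fps_nth (pade_top m) (4 * m + 1) = - (8 / 3) * \<mu> * (\<mu>\<^sup>2 - 1)"
    and "fps_nth (pade_top m) (4 * m) = \<mu> * (\<mu>\<^sup>2 - 1) * (32 * \<mu>\<^sup>2 - 78) / 15"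
    by (simp_all add: \<mu>_def)
qed

section \<open>The remaining approximants and their pivots\<close>

lemma fps_mult_nth_eq_0:
  fixes f g :: "'a::comm_ring_1 fps"
  assumes "\<And>l. l > a \<Longrightarrow> fps_nth f l = 0" "\<And>l. l > b \<Longrightarrow> fps_nth g l = 0" "l > a + b"
  shows "fps_nth (f * g) l = 0"
  unfolding fps_mult_nth
proof (rule sum.neutral, rule ballI)
  fix i assume "i \<in> {0..l}"
  then have "i > a \<or> l - i > b" using assms(3) by auto
  then show "fps_nth f i * fps_nth g (l - i) = 0" using assms(1,2) by auto
qed

lemma pade_pivot_0: "pade_pivot (catalan_fps ^ 8) (4 * m) (pade_denom (Suc m)) 1"
  unfolding pade_pivot_def
proof (intro conjI exI)
  show "pade_denom (Suc m) * catalan_fps ^ 8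
      = pade_denom m + fps_X ^ (2 * (4 * m)) * catalan_fps ^ (8 * m + 8)"
    by (simp add: pade_denom_mult_catalan)
qed (auto simp: pade_denom_nth_0 catalan_fps_nth_0 fps_power_zeroth intro!: pade_denom_nth_eq_0)

text \<open>The error terms of the two approximants combine to X^(8m + 2e) (A C^(8m + 8) + X^(8 - 2e) B
C^(8m + 16)), whose leading coefficient is A(0) because e < 4. The numerator has degree at most
4m + e - 1 by the degree bounds alone, whereas those bounds only give degree 4m + e + 3 for the
denominator; the last assumption removes the excess. Its indices are shifted by 2 as in
\<open>pade_top\<close>.\<close>

lemma pade_pivot_combination:
  fixes A B :: "rat fps" and e m :: nat
  defines "D \<equiv> B * pade_denom (Suc (Suc m)) + fps_X ^ (2 * e) * A * pade_denom (Suc m)"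
  assumes e: "1 \<le> e" "e \<le> 3"
    and B: "fps_nth B 0 = 1" "\<And>l. l > e - 1 \<Longrightarrow> fps_nth B l = 0"
    and A: "\<And>l. l > 3 - e \<Longrightarrow> fps_nth A l = 0"
    and top: "\<And>l. l \<in> {3, 4, 5} \<Longrightarrow>
      fps_nth (B * pade_top (Suc m) + fps_X ^ (2 * e) * A * pade_top m) (4 * m + e + l) = 0"
  shows "pade_pivot (catalan_fps ^ 8) (4 * m + e) D (fps_nth A 0)"
  unfolding pade_pivot_def
proof (intro conjI exI allI impI)
  let ?C = catalan_fps
  let ?N = "B * pade_denom (Suc m) + fps_X ^ (2 * e) * A * pade_denom m"
  let ?E = "A * ?C ^ (8 * m + 8) + fps_X ^ (8 - 2 * e) * B * ?C ^ (8 * m + 16)"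
  show "fps_nth D 0 = 1"
    using e by (simp add: D_def B pade_denom_nth_0 del: pade_denom.simps)
  have XA: "fps_nth (fps_X ^ (2 * e) * A) l = 0" if "l > 3 + e" for l
    using that e by (auto simp: fps_X_power_mult_nth intro!: A)
  show "fps_nth D l = 0" if "4 * m + e < l" for l
  proof (cases "l \<le> 4 * m + e + 3")
    case True
    have "fps_X ^ 2 * D = B * pade_top (Suc m) + fps_X ^ (2 * e) * A * pade_top m"
      by (simp add: D_def pade_top_def algebra_simps)
    moreover have "fps_nth (B * pade_top (Suc m) + fps_X ^ (2 * e) * A * pade_top m) (l + 2) = 0"
      using top[of "l + 2 - (4 * m + e)"] True that by force
    ultimately have "fps_nth (fps_X ^ 2 * D) (l + 2) = 0"
      by simp
    then show ?thesis by (simp add: fps_X_power_mult_nth)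
  next
    case False
    have "fps_nth (B * pade_denom (Suc (Suc m))) l = 0"
      by (rule fps_mult_nth_eq_0[where a = "e - 1" and b = "4 * m + 4"])
        (use e False in \<open>auto intro!: B pade_denom_nth_eq_0 simp del: pade_denom.simps\<close>)
    moreover have "fps_nth (fps_X ^ (2 * e) * A * pade_denom (Suc m)) l = 0"
      by (rule fps_mult_nth_eq_0[where a = "3 + e" and b = "4 * m"])
        (use e False in \<open>auto intro!: XA pade_denom_nth_eq_0 simp del: pade_denom.simps\<close>)
    ultimately show ?thesis by (simp add: D_def del: pade_denom.simps)
  qed
  show "D * ?C ^ 8 = ?N + fps_X ^ (2 * (4 * m + e)) * ?E"
  proof -
    have "D * ?C ^ 8 = B * (pade_denom (Suc (Suc m)) * ?C ^ 8)
        + fps_X ^ (2 * e) * A * (pade_denom (Suc m) * ?C ^ 8)"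
      by (simp add: D_def algebra_simps)
    also have "\<dots> = ?N + fps_X ^ (2 * e) * A * (fps_X ^ (8 * m) * ?C ^ (8 * m + 8))
        + B * (fps_X ^ (8 * Suc m) * ?C ^ (8 * Suc m + 8))"
      unfolding pade_denom_mult_catalan by (simp add: algebra_simps)
    also have "fps_X ^ (8 * Suc m) = (fps_X ^ (2 * (4 * m + e)) * fps_X ^ (8 - 2 * e) :: rat fps)"
      using e by (simp flip: power_add)
    also have "fps_X ^ (2 * e) * A * (fps_X ^ (8 * m) * ?C ^ (8 * m + 8))
        = fps_X ^ (2 * (4 * m + e)) * A * ?C ^ (8 * m + 8)"
      by (simp add: power_add mult_ac)
    finally show ?thesis by (simp add: algebra_simps)
  qed
  show "fps_nth ?N l = 0" if "4 * m + e \<le> l" for l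
  proof -
    have "fps_nth (B * pade_denom (Suc m)) l = 0"
      by (rule fps_mult_nth_eq_0[where a = "e - 1" and b = "4 * m"])
        (use e that in \<open>auto intro!: B pade_denom_nth_eq_0 simp del: pade_denom.simps\<close>)
    moreover have "fps_nth (fps_X ^ (2 * e) * A * pade_denom m) l = 0"
    proof (cases m)
      case (Suc m')
      show ?thesis
        by (rule fps_mult_nth_eq_0[where a = "3 + e" and b = "4 * m'"])
          (use e that Suc in \<open>auto intro!: XA pade_denom_nth_eq_0 simp del: pade_denom.simps\<close>)
    qed simp
    ultimately show ?thesis by simp
  qed
  show "fps_nth ?E 0 = fps_nth A 0"
    using e by (simp add: catalan_fps_nth_0 fps_power_zeroth)
qed

text \<open>The quadratics \<open>K\<close> and \<open>L\<close> are the irreducible quadratic factors of the determinants of order 4m + 2 and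
4m + 3, written in \<open>\<mu> = m + 1\<close>.\<close>

context
  fixes m :: nat and \<mu> K L :: rat
  defines "\<mu> \<equiv> of_nat m + 1"
    and "K \<equiv> 64 * \<mu>\<^sup>2 - 96 * \<mu> - 43"
    and "L \<equiv> 64 * \<mu>\<^sup>2 + 224 * \<mu> + 117"
begin

text \<open>The roots of \<open>K\<close> are avoided by parity: its value at an integer is odd.\<close>

lemma pivot_factors_nonzero: "\<mu> \<noteq> 0" "2 * \<mu> + 1 \<noteq> 0" "K \<noteq> 0" "L \<noteq> 0"
proof -
  have "odd (64 * (int m + 1)\<^sup>2 - 96 * (int m + 1) - 43)"
    by simp
  then have "64 * (int m + 1)\<^sup>2 - 96 * (int m + 1) - 43 \<noteq> 0"
    by (metis even_zero)
  then have "(of_int (64 * (int m + 1)\<^sup>2 - 96 * (int m + 1) - 43) :: rat) \<noteq> 0"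
    by (simp only: of_int_eq_0_iff not_False_eq_True)
  then show "K \<noteq> 0" by (simp add: K_def \<mu>_def)
  have "\<mu> > 0" by (simp add: \<mu>_def add_nonneg_pos)
  then show "\<mu> \<noteq> 0" "2 * \<mu> + 1 \<noteq> 0" "L \<noteq> 0"
    by (simp_all add: L_def add_pos_pos less_imp_neq[symmetric])
qed

lemma pade_top_nth_\<mu>:
  shows "fps_nth (pade_top m) (4 * m + 2) = \<mu>"
    and "fps_nth (pade_top m) (4 * m + 1) = - (8 / 3) * \<mu> * (\<mu>\<^sup>2 - 1)"
    and "fps_nth (pade_top m) (4 * m) = \<mu> * (\<mu>\<^sup>2 - 1) * (32 * \<mu>\<^sup>2 - 78) / 15"
  using pade_top_nth[of m] by (simp_all add: \<mu>_def)

lemma pade_top_Suc_nth_\<mu>: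
  shows "fps_nth (pade_top (Suc m)) (4 * m + 6) = \<mu> + 1"
    and "fps_nth (pade_top (Suc m)) (4 * m + 5) = - (8 / 3) * (\<mu> + 1) * ((\<mu> + 1)\<^sup>2 - 1)"
    and "fps_nth (pade_top (Suc m)) (4 * m + 4) =
      (\<mu> + 1) * ((\<mu> + 1)\<^sup>2 - 1) * (32 * (\<mu> + 1)\<^sup>2 - 78) / 15"
  using pade_top_nth[of "Suc m"] by (simp_all add: \<mu>_def add_ac)

text \<open>In each of the next three lemmas the coefficients of \<open>A\<close> and \<open>B\<close> are the solution of a linear
system: the three equations in the proof say, from the top degree downwards, that the denominator has no
coefficient beyond its permitted degree.\<close>

lemma pade_pivot_1:
  "\<exists>D. pade_pivot (catalan_fps ^ 8) (4 * m + 1) D (2 / 45 * (\<mu> + 1) * (2 * \<mu> + 1) * K / \<mu>)"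
proof -
  define a0 a1 a2 where "a0 = 2 / 45 * (\<mu> + 1) * (2 * \<mu> + 1) * K / \<mu>"
    and "a1 = 8 / 3 * (\<mu> + 1) * (2 * \<mu> + 1) / \<mu>" and "a2 = - (\<mu> + 1) / \<mu>"
  define A where "A = fps_const a0 + fps_const a1 * fps_X + fps_const a2 * fps_X ^ 2"
  have sum: "1 * pade_top (Suc m) + fps_X ^ (2 * 1) * A * pade_top m = pade_top (Suc m)
      + fps_const a0 * (fps_X ^ 2 * pade_top m) + fps_const a1 * (fps_X ^ 3 * pade_top m)
      + fps_const a2 * (fps_X ^ 4 * pade_top m)"
    unfolding A_def by (simp add: algebra_simps power_numeral_reduce)
  have "pade_pivot (catalan_fps ^ 8) (4 * m + 1)
     (1 * pade_denom (Suc (Suc m)) + fps_X ^ (2 * 1) * A * pade_denom (Suc m)) (fps_nth A 0)"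
  proof (rule pade_pivot_combination)
    fix l :: nat assume "l \<in> {3, 4, 5}"
    moreover have "(\<mu> + 1) + a2 * \<mu> = 0"
      using pivot_factors_nonzero by (simp add: a2_def)
    moreover have "- (8 / 3) * (\<mu> + 1) * ((\<mu> + 1)\<^sup>2 - 1) + a1 * \<mu>
        + a2 * (- (8 / 3) * \<mu> * (\<mu>\<^sup>2 - 1)) = 0"
      using pivot_factors_nonzero by (simp add: a1_def a2_def field_simps power2_eq_square)
    moreover have "(\<mu> + 1) * ((\<mu> + 1)\<^sup>2 - 1) * (32 * (\<mu> + 1)\<^sup>2 - 78) / 15 + a0 * \<mu>
        + a1 * (- (8 / 3) * \<mu> * (\<mu>\<^sup>2 - 1)) + a2 * (\<mu> * (\<mu>\<^sup>2 - 1) * (32 * \<mu>\<^sup>2 - 78) / 15) = 0"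
      using pivot_factors_nonzero by (simp add: a0_def a1_def a2_def K_def field_simps power2_eq_square)
    ultimately show "fps_nth (1 * pade_top (Suc m) + fps_X ^ (2 * 1) * A * pade_top m) (4 * m + 1 + l) = 0"
      unfolding sum
      by (auto simp: fps_X_power_mult_nth pade_top_nth_eq_0 pade_top_nth_\<mu>
        pade_top_nth_\<mu>(1,2)[simplified] pade_top_Suc_nth_\<mu> add.commute[of _ "4 * m"])
  qed (auto simp: A_def fps_X_power_nth)
  then show ?thesis by (auto simp: A_def a0_def)
qed

lemma pade_pivot_2:
  "\<exists>D. pade_pivot (catalan_fps ^ 8) (4 * m + 2) D (- (\<mu> + 1) * L / (\<mu> * K))"
proof -
  define a0 a1 b where "a0 = - (\<mu> + 1) * L / (\<mu> * K)"
    and "a1 = 60 * (\<mu> + 1) / (\<mu> * K)" and "b = - 60 / K"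
  define A B where "A = fps_const a0 + fps_const a1 * fps_X" and "B = 1 + fps_const b * fps_X"
  have sum: "B * pade_top (Suc m) + fps_X ^ (2 * 2) * A * pade_top m = pade_top (Suc m)
      + fps_const b * (fps_X ^ 1 * pade_top (Suc m))
      + fps_const a0 * (fps_X ^ 4 * pade_top m) + fps_const a1 * (fps_X ^ 5 * pade_top m)"
    unfolding A_def B_def by (simp add: algebra_simps power_numeral_reduce)
  have "pade_pivot (catalan_fps ^ 8) (4 * m + 2)
     (B * pade_denom (Suc (Suc m)) + fps_X ^ (2 * 2) * A * pade_denom (Suc m)) (fps_nth A 0)"
  proof (rule pade_pivot_combination)
    fix l :: nat assume "l \<in> {3, 4, 5}"
    moreover have "b * (\<mu> + 1) + a1 * \<mu> = 0"
      using pivot_factors_nonzero by (simp add: a1_def b_def)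
    moreover have "(\<mu> + 1) + b * (- (8 / 3) * (\<mu> + 1) * ((\<mu> + 1)\<^sup>2 - 1)) + a0 * \<mu>
        + a1 * (- (8 / 3) * \<mu> * (\<mu>\<^sup>2 - 1)) = 0"
    proof -
      have "a0 * \<mu> = - (\<mu> + 1) * L / K" "a1 * \<mu> = 60 * (\<mu> + 1) / K"
        using pivot_factors_nonzero by (simp_all add: a0_def a1_def)
      then show ?thesis
        using pivot_factors_nonzero by (simp add: a0_def a1_def b_def field_simps)
        (simp add: K_def L_def algebra_simps power2_eq_square)
    qed
    moreover have "- (8 / 3) * (\<mu> + 1) * ((\<mu> + 1)\<^sup>2 - 1)
        + b * ((\<mu> + 1) * ((\<mu> + 1)\<^sup>2 - 1) * (32 * (\<mu> + 1)\<^sup>2 - 78) / 15)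
        + a0 * (- (8 / 3) * \<mu> * (\<mu>\<^sup>2 - 1))
        + a1 * (\<mu> * (\<mu>\<^sup>2 - 1) * (32 * \<mu>\<^sup>2 - 78) / 15) = 0"
      (is "?t = 0")
    proof -
      \<comment> \<open>Multiplying by the common denominator leaves a polynomial identity in \<open>\<mu>\<close>.\<close>
      have "K * ?t = - (8 / 3) * (\<mu> + 1) * ((\<mu> + 1)\<^sup>2 - 1) * K
          + (b * K) * ((\<mu> + 1) * ((\<mu> + 1)\<^sup>2 - 1) * (32 * (\<mu> + 1)\<^sup>2 - 78) / 15)
          + (a0 * \<mu> * K) * (- (8 / 3) * (\<mu>\<^sup>2 - 1))
          + (a1 * \<mu> * K) * ((\<mu>\<^sup>2 - 1) * (32 * \<mu>\<^sup>2 - 78) / 15)"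
        by (simp add: algebra_simps)
      also have "\<dots> = - (8 / 3) * (\<mu> + 1) * ((\<mu> + 1)\<^sup>2 - 1) * K
          + - 60 * ((\<mu> + 1) * ((\<mu> + 1)\<^sup>2 - 1) * (32 * (\<mu> + 1)\<^sup>2 - 78) / 15)
          + (- (\<mu> + 1) * L) * (- (8 / 3) * (\<mu>\<^sup>2 - 1))
          + (60 * (\<mu> + 1)) * ((\<mu>\<^sup>2 - 1) * (32 * \<mu>\<^sup>2 - 78) / 15)"
        using pivot_factors_nonzero by (simp add: a0_def a1_def b_def)
      also have "\<dots> = 0"
        unfolding K_def L_def by (simp add: field_simps power2_eq_square)
      finally show ?thesis using pivot_factors_nonzero by simp
    qed
    ultimately show "fps_nth (B * pade_top (Suc m) + fps_X ^ (2 * 2) * A * pade_top m) (4 * m + 2 + l) = 0"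
      unfolding sum
      by (auto simp: fps_X_power_mult_nth pade_top_nth_eq_0 pade_top_nth_\<mu>
        pade_top_nth_\<mu>(1,2)[simplified] pade_top_Suc_nth_\<mu> add.commute[of _ "4 * m"])
  qed (auto simp: A_def B_def fps_X_power_nth)
  then show ?thesis by (auto simp: A_def a0_def)
qed

lemma pade_pivot_3:
  "\<exists>D. pade_pivot (catalan_fps ^ 8) (4 * m + 3) D (- (45 / 2) * (\<mu> + 1) / (\<mu> * (2 * \<mu> + 1) * L))"
proof -
  define a0 b1 b2 where "a0 = - (45 / 2) * (\<mu> + 1) / (\<mu> * (2 * \<mu> + 1) * L)"
    and "b1 = 60 / L" and "b2 = 45 / 2 / ((2 * \<mu> + 1) * L)"
  define A B where "A = fps_const a0"
    and "B = 1 + fps_const b1 * fps_X + fps_const b2 * fps_X ^ 2"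
  have a0_eq: "a0 * \<mu> = - (b2 * (\<mu> + 1))"
  proof -
    have "a0 = - (b2 * (\<mu> + 1)) / \<mu>"
      unfolding a0_def b2_def by (simp add: mult_ac)
    then show ?thesis using pivot_factors_nonzero(1) by simp
  qed
  have b1_eq: "b1 = 8 / 3 * ((2 * \<mu> + 1) * b2)"
  proof -
    have "w * (45 / 2 / (w * L)) = 45 / 2 / L" if "w \<noteq> 0" for w
      using that by simp
    from this[OF pivot_factors_nonzero(2)] have "(2 * \<mu> + 1) * b2 = 45 / 2 / L"
      unfolding b2_def .
    then show ?thesis by (simp only: b1_def)
  qed
  have sum: "B * pade_top (Suc m) + fps_X ^ (2 * 3) * A * pade_top m = pade_top (Suc m)
      + fps_const b1 * (fps_X ^ 1 * pade_top (Suc m)) + fps_const b2 * (fps_X ^ 2 * pade_top (Suc m))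
      + fps_const a0 * (fps_X ^ 6 * pade_top m)"
    unfolding A_def B_def by (simp add: algebra_simps power_numeral_reduce)
  have "pade_pivot (catalan_fps ^ 8) (4 * m + 3)
     (B * pade_denom (Suc (Suc m)) + fps_X ^ (2 * 3) * A * pade_denom (Suc m)) (fps_nth A 0)"
  proof (rule pade_pivot_combination)
    fix l :: nat assume "l \<in> {3, 4, 5}"
    moreover have "b2 * (\<mu> + 1) + a0 * \<mu> = 0"
      using pivot_factors_nonzero by (simp add: a0_def b2_def)
    moreover have "b1 * (\<mu> + 1) + b2 * (- (8 / 3) * (\<mu> + 1) * ((\<mu> + 1)\<^sup>2 - 1))
        + a0 * (- (8 / 3) * \<mu> * (\<mu>\<^sup>2 - 1)) = 0" (is "?t = 0")
    proof -
      have "?t = b1 * (\<mu> + 1) + b2 * (- (8 / 3) * (\<mu> + 1) * ((\<mu> + 1)\<^sup>2 - 1))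
          - (8 / 3) * (a0 * \<mu>) * (\<mu>\<^sup>2 - 1)"
        by simp
      also have "\<dots> = 0"
        unfolding a0_eq b1_eq by (simp add: field_simps power2_eq_square)
      finally show ?thesis .
    qed
    moreover have "(\<mu> + 1) + b1 * (- (8 / 3) * (\<mu> + 1) * ((\<mu> + 1)\<^sup>2 - 1))
        + b2 * ((\<mu> + 1) * ((\<mu> + 1)\<^sup>2 - 1) * (32 * (\<mu> + 1)\<^sup>2 - 78) / 15)
        + a0 * (\<mu> * (\<mu>\<^sup>2 - 1) * (32 * \<mu>\<^sup>2 - 78) / 15) = 0" (is "?t = 0")
    proof -
      have "?t = (\<mu> + 1) + b1 * (- (8 / 3) * (\<mu> + 1) * ((\<mu> + 1)\<^sup>2 - 1))
          + b2 * ((\<mu> + 1) * ((\<mu> + 1)\<^sup>2 - 1) * (32 * (\<mu> + 1)\<^sup>2 - 78) / 15)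
          + (a0 * \<mu>) * ((\<mu>\<^sup>2 - 1) * (32 * \<mu>\<^sup>2 - 78) / 15)"
        by simp
      also have "\<dots> = (\<mu> + 1) * (1 - 2 / 45 * (b2 * ((2 * \<mu> + 1) * L)))"
        unfolding a0_eq b1_eq L_def by (simp add: field_simps power2_eq_square)
      also have "\<dots> = 0"
        using pivot_factors_nonzero by (simp add: b2_def)
      finally show ?thesis .
    qed
    ultimately show "fps_nth (B * pade_top (Suc m) + fps_X ^ (2 * 3) * A * pade_top m) (4 * m + 3 + l) = 0"
      unfolding sum
      by (auto simp: fps_X_power_mult_nth pade_top_nth_eq_0 pade_top_nth_\<mu>
        pade_top_nth_\<mu>(1,2)[simplified] pade_top_Suc_nth_\<mu> add.commute[of _ "4 * m"])
  qed (auto simp: A_def B_def fps_X_power_nth)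
  then show ?thesis by (auto simp: A_def a0_def)
qed

end

lemma pade_pivot_exists: "\<exists>D h. pade_pivot (catalan_fps ^ 8) k D h"
proof -
  have k: "k = 4 * (k div 4) + k mod 4" by simp
  have "k mod 4 = 0 \<or> k mod 4 = 1 \<or> k mod 4 = 2 \<or> k mod 4 = 3" by linarith
  then show ?thesis
    using pade_pivot_0 pade_pivot_1 pade_pivot_2 pade_pivot_3 k by (metis add.right_neutral)
qed

theorem theorem6:
  fixes n :: nat
  shows "hankel_det (4 * n) (catalan_power_fps 8) = (of_nat n + 1) ^ 3
    \<and> hankel_det (4 * n + 1) (catalan_power_fps 8) = (of_nat n + 1) ^ 3
    \<and> hankel_det (4 * n + 2) (catalan_power_fps 8) =
           2 / 45 * (of_nat n + 1)^2 * (of_nat n + 2) * (2 * of_nat n + 3)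
             * (64 * (of_nat n)^2 + 32 * of_nat n - 75)
    \<and> hankel_det (4 * n + 3) (catalan_power_fps 8) =
           - (2 / 45) * (of_nat n + 1) * (of_nat n + 2)^2 * (2 * of_nat n + 3)
             * (64 * (of_nat n)^2 + 352 * of_nat n + 405)"
proof -
  let ?H = "\<lambda>n. hankel_det n (catalan_power_fps 8)"
  have step: "?H (Suc k) = h * ?H k" if "\<exists>D. pade_pivot (catalan_fps ^ 8) k D h" for k h
    using that hankel_det_Suc[OF pade_pivot_exists] unfolding catalan_power_fps_def by blast
  define K L where "K = (\<lambda>\<mu>::rat. 64 * \<mu>\<^sup>2 - 96 * \<mu> - 43)"
    and "L = (\<lambda>\<mu>::rat. 64 * \<mu>\<^sup>2 + 224 * \<mu> + 117)"
  \<comment> \<open>Each block of four determinants follows from its first one, and its last one is the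
    first of the next block.\<close>
  have from_0: "?H (4 * n + 1) = \<mu> ^ 3 \<and>
      ?H (4 * n + 2) = 2 / 45 * \<mu>\<^sup>2 * (\<mu> + 1) * (2 * \<mu> + 1) * K \<mu> \<and>
      ?H (4 * n + 3) = - (2 / 45) * \<mu> * (\<mu> + 1)\<^sup>2 * (2 * \<mu> + 1) * L \<mu> \<and>
      ?H (4 * n + 4) = (\<mu> + 1) ^ 3"
    if H0: "?H (4 * n) = \<mu> ^ 3" and \<mu>: "\<mu> = of_nat n + 1" for n \<mu>
  proof -
    have nz: "\<mu> \<noteq> 0" "2 * \<mu> + 1 \<noteq> 0" "K \<mu> \<noteq> 0" "L \<mu> \<noteq> 0"
      unfolding K_def L_def \<mu> by (rule pivot_factors_nonzero)+
    have H1: "?H (4 * n + 1) = \<mu> ^ 3"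
      using step[OF exI, OF pade_pivot_0[of n]] H0 by simp
    have "?H (4 * n + 2) = 2 / 45 * (\<mu> + 1) * (2 * \<mu> + 1) * K \<mu> / \<mu> * ?H (4 * n + 1)"
      (is "_ = ?rhs")
      using step[OF pade_pivot_1[of n]] by (simp add: K_def \<mu>)
    also have "?rhs = 2 / 45 * \<mu>\<^sup>2 * (\<mu> + 1) * (2 * \<mu> + 1) * K \<mu>"
      unfolding H1 using nz(1) by (simp add: field_simps power2_eq_square power3_eq_cube)
    finally have H2: "?H (4 * n + 2) = 2 / 45 * \<mu>\<^sup>2 * (\<mu> + 1) * (2 * \<mu> + 1) * K \<mu>" .
    have "?H (4 * n + 3) = - (\<mu> + 1) * L \<mu> / (\<mu> * K \<mu>) * ?H (4 * n + 2)"
      (is "_ = ?rhs")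
      using step[OF pade_pivot_2[of n]] by (simp add: K_def L_def \<mu> numeral_3_eq_3)
    also have "?rhs = - (2 / 45) * \<mu> * (\<mu> + 1)\<^sup>2 * (2 * \<mu> + 1) * L \<mu>"
      unfolding H2 using nz(1,3) by (simp add: field_simps power2_eq_square)
    finally have H3: "?H (4 * n + 3) = - (2 / 45) * \<mu> * (\<mu> + 1)\<^sup>2 * (2 * \<mu> + 1) * L \<mu>" .
    have "?H (4 * n + 4) = - (45 / 2) * (\<mu> + 1) / (\<mu> * (2 * \<mu> + 1) * L \<mu>) * ?H (4 * n + 3)"
      (is "_ = ?rhs")
      using step[OF pade_pivot_3[of n]] by (simp add: L_def \<mu> numeral_eq_Suc)
    also have "?rhs = (\<mu> + 1) ^ 3"
    proof -
      have "- (45 / 2) * (\<mu> + 1) / d * (- (2 / 45) * (\<mu> + 1)\<^sup>2 * d) = (\<mu> + 1) ^ 3"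
        if "d \<noteq> 0" for d
        using that by (simp add: power2_eq_square power3_eq_cube)
      from this[of "\<mu> * (2 * \<mu> + 1) * L \<mu>"] show ?thesis
        unfolding H3 using nz by (simp add: mult_ac)
    qed
    finally have H4: "?H (4 * n + 4) = (\<mu> + 1) ^ 3" .
    from H1 H2 H3 H4 show ?thesis by blast
  qed
  have H0: "?H (4 * n) = (of_nat n + 1) ^ 3" for n
  proof (induction n)
    case 0
    show ?case by (simp add: hankel_det_0)
  next
    case (Suc n)
    then show ?case using from_0[OF Suc refl] by (simp add: add_ac)
  qed
  show ?thesis
    using from_0[OF H0 refl] H0 by (simp add: K_def L_def power2_eq_square algebra_simps)
qed

end
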